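(* Assume the set $\Sigma$ of saddle points of $L$ is non-empty. Let $(x,y,\lambda):[0,+\infty)\to X\times Y\times Z$ be a solution of the generalized Arrow--Hurwicz differential system (GAH) and let $(\sigma,\tau,\omega):(0,+\infty)\to X\times Y\times Z$ be its Cesàro average, $$(\sigma(t),\tau(t),\omega(t))=\frac1t\int_0^t(x(s),y(s),\lambda(s))\,\mathrm ds .$$ Then, for any $(\xi,\psi,\eta)\in\Sigma$, $$L(\sigma(t),\tau(t),\eta)-L(\xi,\psi,\omega(t))=\mathcal O\Big(\frac1t\Big)\quad\text{as } t\to+\infty .$$ Moreover, there exists $(\bar x,\bar y,\bar\lambda)\in\Sigma$ such that $(\sigma(t),\tau(t),\omega(t))\rightharpoonup(\bar x,\bar y,\bar\lambda)$ weakly in $X\times Y\times Z$ as $t\to+\infty$.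
   Context: $X$, $Y$, $Z$ are real Hilbert spaces; $X\times Y\times Z$ carries the product Hilbert structure $\langle\cdot,\cdot\rangle=\langle\cdot,\cdot\rangle_X+\langle\cdot,\cdot\rangle_Y+\langle\cdot,\cdot\rangle_Z$, with norm $\|\cdot\|$. Standing assumptions: $f:X\to\mathbb R$ and $g:Y\to\mathbb R$ are convex and continuously differentiable; $\nabla f:X\to X$ and $\nabla g:Y\to Y$ are Lipschitz continuous on bounded sets; $A:X\to Z$ and $B:Y\to Z$ are linear and continuous, with adjoints $A^*,B^*$; $c\in Z$. The Lagrangian is $L:X\times Y\times Z\to\mathbb R$, $L(x,y,\lambda)=f(x)+g(y)+\langle\lambda,Ax+By-c\rangle_Z$. A saddle point of $L$ is a triple $(\bar x,\bar y,\bar\lambda)\in X\times Y\times Z$ with $L(\bar x,\bar y,\lambda)\le L(\bar x,\bar y,\bar\lambda)\le L(x,y,\bar\lambda)$ for all $(x,y,\lambda)\in X\times Y\times Z$; $\Sigma\subset X\times Y\times Z$ denotes the set of all saddle points of $L$. The system (GAH) is $$\dot x+\nabla f(x)+A^*\lambda=0_X,\qquad \dot y+\nabla g(y)+B^*\lambda=0_Y,\qquad \dot\lambda+c-Ax-By=0_Z,$$ with initial data $(x(0),y(0),\lambda(0))=(x_0,y_0,\lambda_0)\in X\times Y\times Z$; a solution is a function of class $\mathcal C^1$ on $[0,+\infty)$ with values in $X\times Y\times Z$ satisfying the system on $[0,+\infty)$ with these initial data. *)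

theory Defs
  imports "HOL-Analysis.Analysis" "HOL-Library.Landau_Symbols"
begin

definition cont_differentiable :: "('a::real_normed_vector \<Rightarrow> real) \<Rightarrow> bool" where
  "cont_differentiable f \<longleftrightarrow>
     (\<exists>f' :: 'a \<Rightarrow> 'a \<Rightarrow>\<^sub>L real.
        (\<forall>x. (f has_derivative blinfun_apply (f' x)) (at x)) \<and> continuous_on UNIV f')"

text \<open>A gradient is unique when it exists. On a Hilbert space it exists wherever the function is
  Frechet differentiable; elsewhere the value below is unspecified.\<close>
definition gradient :: "('a::real_inner \<Rightarrow> real) \<Rightarrow> 'a \<Rightarrow> 'a" where
  "gradient f x = (THE D. GDERIV f x :> D)"

definition lipschitz_on_bounded_sets ::
    "('a::metric_space \<Rightarrow> 'b::metric_space) \<Rightarrow> bool" where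
  "lipschitz_on_bounded_sets h \<longleftrightarrow> (\<forall>S. bounded S \<longrightarrow> (\<exists>C. lipschitz_on C S h))"

definition lagrangian ::
    "('x \<Rightarrow> real) \<Rightarrow> ('y \<Rightarrow> real) \<Rightarrow> ('x \<Rightarrow> 'z) \<Rightarrow> ('y \<Rightarrow> 'z) \<Rightarrow> 'z
      \<Rightarrow> 'x \<Rightarrow> 'y \<Rightarrow> 'z::real_inner \<Rightarrow> real" where
  "lagrangian f g A B c x y l = f x + g y + inner l (A x + B y - c)"

definition saddle_points :: "('x \<Rightarrow> 'y \<Rightarrow> 'z \<Rightarrow> real) \<Rightarrow> ('x \<times> 'y \<times> 'z) set" where
  "saddle_points L =
     {(x', y', l'). \<forall>x y l. L x' y' l \<le> L x' y' l' \<and> L x' y' l' \<le> L x y l'}"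

text \<open>Trajectories are total functions on the reals, of which only the values on \<open>[0, \<infinity>)\<close> matter;
  the derivative at \<open>0\<close> is one-sided. In \<open>adjoint\<close>, the library picks some map with the adjoint
  property; for bounded linear maps between Hilbert spaces it exists and is unique.\<close>
definition gah_solution ::
    "('x \<Rightarrow> real) \<Rightarrow> ('y \<Rightarrow> real) \<Rightarrow> ('x \<Rightarrow> 'z) \<Rightarrow> ('y \<Rightarrow> 'z) \<Rightarrow> 'z
      \<Rightarrow> 'x \<Rightarrow> 'y \<Rightarrow> 'z
      \<Rightarrow> (real \<Rightarrow> 'x::real_inner) \<Rightarrow> (real \<Rightarrow> 'y::real_inner) \<Rightarrow> (real \<Rightarrow> 'z::real_inner) \<Rightarrow> bool" where
  "gah_solution f g A B c x0 y0 l0 x y l \<longleftrightarrow>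
     x 0 = x0 \<and> y 0 = y0 \<and> l 0 = l0 \<and>
     (\<exists>x' y' l'.
        continuous_on {0..} x' \<and> continuous_on {0..} y' \<and> continuous_on {0..} l' \<and>
        (\<forall>t\<ge>0.
           (x has_vector_derivative x' t) (at t within {0..}) \<and>
           (y has_vector_derivative y' t) (at t within {0..}) \<and>
           (l has_vector_derivative l' t) (at t within {0..}) \<and>
           x' t + gradient f (x t) + adjoint A (l t) = 0 \<and>
           y' t + gradient g (y t) + adjoint B (l t) = 0 \<and>
           l' t + c - A (x t) - B (y t) = 0))"

definition cesaro_average :: "(real \<Rightarrow> 'a::real_normed_vector) \<Rightarrow> real \<Rightarrow> 'a" where
  "cesaro_average u t = (1 / t) *\<^sub>R integral {0..t} u"

definition weakly_tendsto :: "('i \<Rightarrow> 'a::real_normed_vector) \<Rightarrow> 'a \<Rightarrow> 'i filter \<Rightarrow> bool" where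
  "weakly_tendsto u v F \<longleftrightarrow>
     (\<forall>\<phi> :: 'a \<Rightarrow> real. bounded_linear \<phi> \<longrightarrow> ((\<lambda>i. \<phi> (u i)) \<longlongrightarrow> \<phi> v) F)"

end

theory Submission
  imports Defs
begin

text \<open>
  For \<open>w = (\<xi>, \<psi>, \<eta>)\<close> put \<open>\<Phi> w (x, y, l) = L x y \<eta> - L \<xi> \<psi> l\<close>. This gap is skew-symmetric, convex in its
  second argument, and \<open>v\<close> is a saddle point iff \<open>\<Phi> w v \<le> 0\<close> for all \<open>w\<close>. Convexity of \<open>f\<close> and \<open>g\<close>
  makes the flow \<open>u\<close> satisfy \<open>d/dt |u - w|\<^sup>2 \<le> - 2 \<Phi> w u\<close> for every \<open>w\<close>; integrating and using Jensen's
  inequality, the average \<open>m t\<close> satisfies \<open>\<Phi> w (m t) \<le> |u 0 - w|\<^sup>2 / (2 t)\<close>. Hence every weak cluster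
  point of \<open>m\<close> is a saddle point. For saddle points \<open>v\<close>, \<open>w\<close> the distances \<open>|u - v|\<close>, \<open>|u - w|\<close>
  decrease, so \<open>u \<bullet> (v - w)\<close> and its averages converge; two cluster points \<open>v\<close>, \<open>w\<close> of \<open>m\<close>
  then satisfy \<open>v \<bullet> (v - w) = w \<bullet> (v - w)\<close> and coincide.\<close>

section \<open>Riesz representation, weak convergence, adjoints and gradients\<close>

text \<open>The representing vector is the minimiser of the quadratic functional \<open>J\<close>:
  completeness makes a minimising sequence converge, and vanishing of the first variation at the
  minimiser is the required identity.\<close>

lemma Riesz_representation:
  fixes \<phi> :: "'a::{real_inner, complete_space} \<Rightarrow> real"
  assumes "bounded_linear \<phi>"
  shows "\<exists>v. \<forall>h. \<phi> h = inner v h"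
proof -
  interpret bounded_linear \<phi> by fact
  obtain K where K: "\<And>x. \<bar>\<phi> x\<bar> \<le> norm x * K"
    using bounded by auto
  define J where "J x = inner x x - 2 * \<phi> x" for x
  have Jlow: "J x \<ge> - (K\<^sup>2)" for x
  proof -
    have "0 \<le> (norm x - K)\<^sup>2" by simp
    also have "\<dots> = inner x x - 2 * (norm x * K) + K\<^sup>2"
      by (simp add: power2_eq_square algebra_simps dot_square_norm)
    finally show ?thesis using K[of x] by (simp add: J_def)
  qed
  have bdd: "bdd_below (range J)"
    by (rule bdd_belowI2[OF Jlow])
  define d where "d = Inf (range J)"
  have d_le: "d \<le> J x" for x
    unfolding d_def by (rule cInf_lower[OF _ bdd]) simp
  have "\<exists>x. J x < d + 1 / Suc n" for n
    using cInf_lessD[of "range J" "d + 1 / Suc n"] by (auto simp: d_def)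
  then obtain X where X: "\<And>n. J (X n) < d + 1 / Suc n" by metis
  \<comment> \<open>Parallelogram law: the linear part of \<open>J\<close> cancels at the midpoint,
    and \<open>J\<close> is at least \<open>d\<close> there. Near-minimisers are therefore close to
    each other.\<close>
  have par: "(dist x y)\<^sup>2 \<le> 2 * (J x - d) + 2 * (J y - d)" for x y
  proof -
    have "(dist x y)\<^sup>2 = 2 * J x + 2 * J y - 4 * J ((1/2) *\<^sub>R (x + y))"
      by (simp add: J_def dist_norm power2_norm_eq_inner algebra_simps inner_commute add scaleR)
    then show ?thesis using d_le[of "(1/2) *\<^sub>R (x + y)"] by simp
  qed
  have "Cauchy X"
  proof (rule metric_CauchyI)
    fix e :: real assume "e > 0"
    then obtain N where N: "1 / Suc N < e\<^sup>2 / 4"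
      using nat_approx_posE[of "e\<^sup>2 / 4"] by auto
    have "dist (X m) (X n) < e" if "m \<ge> N" "n \<ge> N" for m n
    proof -
      have "J (X k) < d + e\<^sup>2 / 4" if "k \<ge> N" for k
      proof -
        have "1 / real (Suc k) \<le> 1 / Suc N" using that by (auto simp: frac_le)
        with X[of k] N show ?thesis by linarith
      qed
      then have "J (X m) < d + e\<^sup>2 / 4" "J (X n) < d + e\<^sup>2 / 4" using that by auto
      with par[of "X m" "X n"] have "(dist (X m) (X n))\<^sup>2 < e\<^sup>2"
        by (simp add: field_simps)
      then show ?thesis using \<open>e > 0\<close> by (simp add: power_less_imp_less_base)
    qed
    then show "\<exists>M. \<forall>m\<ge>M. \<forall>n\<ge>M. dist (X m) (X n) < e" by blast
  qed
  then obtain v where v: "X \<longlonglongrightarrow> v"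
    using Cauchy_convergent convergent_def by blast
  have "(\<lambda>n. J (X n)) \<longlonglongrightarrow> J v"
    unfolding J_def by (intro tendsto_intros tendsto v)
  moreover have "(\<lambda>n. d + 1 / Suc n) \<longlonglongrightarrow> d + 0"
    by (intro tendsto_intros) (rule LIMSEQ_Suc[OF lim_1_over_n])
  ultimately have Jv: "J v \<le> d"
    using X by (intro LIMSEQ_le[of "\<lambda>n. J (X n)" _ "\<lambda>n. d + 1 / Suc n"]) (auto intro: less_imp_le)
  have "\<phi> h = inner v h" for h
  proof -
    define a q where "a = inner v h - \<phi> h" and "q = inner h h"
    \<comment> \<open>For nonzero \<open>h\<close> the optimal step from \<open>v\<close> along
      \<open>h\<close> would be \<open>a / q\<close>. The denominator \<open>q + 1\<close> also
      covers \<open>h = 0\<close> and still lowers \<open>J\<close> whenever \<open>a\<close> is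
      nonzero.\<close>
    define s where "s = 1 / (q + 1)"
    have q: "q \<ge> 0" by (simp add: q_def)
    have "0 \<le> J (v + (- a * s) *\<^sub>R h) - J v"
      using Jv d_le[of "v + (- a * s) *\<^sub>R h"] by linarith
    also have "\<dots> = (a * s)\<^sup>2 * q - 2 * s * a\<^sup>2"
      by (simp add: J_def a_def q_def add diff scaleR inner_commute power2_eq_square algebra_simps)
    also have "\<dots> = - (a\<^sup>2 * s * (1 + s))"
    proof -
      have sq: "s * q = 1 - s" using q by (simp add: s_def field_simps)
      have "(a * s)\<^sup>2 * q = a\<^sup>2 * s * (s * q)"
        by (simp add: power2_eq_square)
      also have "\<dots> = a\<^sup>2 * s * (1 - s)" by (simp only: sq)
      finally show ?thesis by (simp add: algebra_simps)
    qed
    finally have "a\<^sup>2 * (s * (1 + s)) \<le> 0" by (simp add: mult.assoc)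
    moreover have "s * (1 + s) > 0"
    proof -
      have "s > 0" using q by (simp add: s_def)
      then show ?thesis by simp
    qed
    ultimately have "a = 0"
      using mult_pos_pos[of "a\<^sup>2" "s * (1 + s)"] by (meson not_less zero_less_power2)
    then show ?thesis by (simp add: a_def)
  qed
  then show ?thesis by blast
qed

lemma weakly_tendsto_iff_inner:
  fixes u :: "'i \<Rightarrow> 'a::{real_inner, complete_space}"
  shows "weakly_tendsto u v F \<longleftrightarrow> (\<forall>h. ((\<lambda>i. inner (u i) h) \<longlongrightarrow> inner v h) F)"
proof
  assume "weakly_tendsto u v F"
  then show "\<forall>h. ((\<lambda>i. inner (u i) h) \<longlongrightarrow> inner v h) F"
    unfolding weakly_tendsto_def using bounded_linear_inner_left by blast
next
  assume lim: "\<forall>h. ((\<lambda>i. inner (u i) h) \<longlongrightarrow> inner v h) F"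
  show "weakly_tendsto u v F"
    unfolding weakly_tendsto_def
  proof (intro allI impI)
    fix \<phi> :: "'a \<Rightarrow> real" assume "bounded_linear \<phi>"
    then obtain w where "\<And>h. \<phi> h = inner h w"
      using Riesz_representation[of \<phi>] by (metis inner_commute)
    then show "((\<lambda>i. \<phi> (u i)) \<longlongrightarrow> \<phi> v) F" using lim by simp
  qed
qed

text \<open>\<open>adjoint\<close> is a Hilbert choice, so its property holds once some adjoint
  exists; Riesz representation of \<open>inner (A x) y\<close> in \<open>x\<close>, for each fixed
  \<open>y\<close>, supplies one.\<close>

lemma adjoint_bounded_linear:
  fixes A :: "'a::{real_inner, complete_space} \<Rightarrow> 'b::real_inner"
  assumes "bounded_linear A"
  shows "inner (adjoint A y) x = inner y (A x)"
proof -
  have "\<exists>v. \<forall>x. inner (A x) y = inner x v" for y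
    using Riesz_representation[OF bounded_linear_compose[OF bounded_linear_inner_left[of y] assms]]
    by (simp add: inner_commute)
  then have "\<exists>A'. \<forall>x y. inner (A x) y = inner x (A' y)" by metis
  then have "\<forall>x y. inner (A x) y = inner x (adjoint A y)"
    unfolding adjoint_def by (rule someI_ex)
  then show ?thesis by (metis inner_commute)
qed

text \<open>\<open>gradient\<close> is a definite description: Riesz representation of the Frechet
  derivative gives existence, and uniqueness of that derivative gives the rest.\<close>

lemma GDERIV_gradient:
  fixes f :: "'a::{real_inner, complete_space} \<Rightarrow> real"
  assumes "cont_differentiable f"
  shows "GDERIV f x :> gradient f x"
proof -
  obtain f' where f': "(f has_derivative f') (at x)"
    using assms unfolding cont_differentiable_def by blast
  obtain D where "\<forall>h. f' h = inner D h"
    using Riesz_representation[OF has_derivative_bounded_linear[OF f']] by blast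
  then have "f' = (\<lambda>h. inner h D)" by (simp add: fun_eq_iff inner_commute)
  then have D: "GDERIV f x :> D"
    using f' by (simp add: gderiv_def)
  moreover have "D' = D" if "GDERIV f x :> D'" for D'
  proof -
    have "(\<lambda>h. inner h D') = (\<lambda>h. inner h D)"
      using has_derivative_unique D that unfolding gderiv_def by blast
    then show ?thesis by (simp add: fun_eq_iff vector_eq_ldot)
  qed
  ultimately show ?thesis
    unfolding gradient_def by (rule theI)
qed

section \<open>The tangent inequality for convex functions\<close>

text \<open>Restriction to the line through \<open>x\<close> and \<open>y\<close> reduces this to a
  convex function of one real variable, compared at 0 and 1.\<close>

lemma convex_on_GDERIV_above_tangent:
  fixes f :: "'a::real_inner \<Rightarrow> real"
  assumes "convex_on UNIV f" and "GDERIV f x :> D"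
  shows "f x + inner D (y - x) \<le> f y"
proof -
  define p where "p t = f (x + t *\<^sub>R (y - x))" for t
  have "convex_on UNIV p"
  proof (rule convex_onI)
    fix t a b :: real assume "0 < t" "t < 1"
    have "x + ((1 - t) * a + t * b) *\<^sub>R (y - x) =
        (1 - t) *\<^sub>R (x + a *\<^sub>R (y - x)) + t *\<^sub>R (x + b *\<^sub>R (y - x))"
      by (simp add: algebra_simps)
    then show "p ((1 - t) *\<^sub>R a + t *\<^sub>R b) \<le> (1 - t) * p a + t * p b"
      using convex_onD[OF assms(1), of t "x + a *\<^sub>R (y - x)" "x + b *\<^sub>R (y - x)"]
        \<open>0 < t\<close> \<open>t < 1\<close> by (simp add: p_def)
  qed simp
  moreover have "(p has_field_derivative inner D (y - x)) (at 0)"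
  proof -
    have f: "(f has_derivative (\<lambda>h. inner h D)) (at (x + 0 *\<^sub>R (y - x)))"
      using assms(2) by (simp add: gderiv_def)
    have "((\<lambda>t. x + t *\<^sub>R (y - x)) has_derivative (\<lambda>t. t *\<^sub>R (y - x))) (at 0)"
      by (auto intro!: derivative_eq_intros)
    from has_derivative_compose[OF this f]
    have "(p has_derivative (\<lambda>t. inner (t *\<^sub>R (y - x)) D)) (at 0)"
      unfolding p_def[abs_def] .
    moreover have "(\<lambda>t. inner (t *\<^sub>R (y - x)) D) = (*) (inner D (y - x))"
      by (auto simp: fun_eq_iff inner_commute)
    ultimately show ?thesis by (simp add: has_field_derivative_def)
  qed
  ultimately have "inner D (y - x) * (1 - 0) \<le> p 1 - p 0"
    by (intro convex_on_imp_above_tangent[of UNIV]) auto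
  then show ?thesis by (simp add: p_def)
qed

section \<open>Integrals and Cesaro averages of Hilbert-valued functions\<close>

text \<open>The library integrates continuous functions with values in class \<open>banach\<close>, to which a type
  of sort \<open>{real_inner, complete_space}\<close> does not belong; its dual does, and the Riesz isomorphism
  transports the integral back.\<close>
lemma integrable_continuous_Hilbert:
  fixes u :: "real \<Rightarrow> 'a::{real_inner, complete_space}"
  assumes "continuous_on {a..b} u"
  shows "u integrable_on {a..b}"
proof -
  define R :: "('a \<Rightarrow>\<^sub>L real) \<Rightarrow> 'a" where
    "R \<phi> = (SOME v. \<forall>h. blinfun_apply \<phi> h = inner v h)" for \<phi>
  have "\<forall>h. blinfun_apply \<phi> h = inner (R \<phi>) h" for \<phi>
    unfolding R_def by (rule someI_ex[OF Riesz_representation[OF blinfun.bounded_linear_right]])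
  then have R: "inner (R \<phi>) h = blinfun_apply \<phi> h" for \<phi> h by metis
  have "bounded_linear R"
  proof (rule bounded_linear_intro)
    show "R (\<phi> + \<psi>) = R \<phi> + R \<psi>" for \<phi> \<psi>
      by (rule vector_eq_rdot[THEN iffD1]) (simp add: R inner_add_left blinfun.add_left)
    show "R (r *\<^sub>R \<phi>) = r *\<^sub>R R \<phi>" for r \<phi>
      by (rule vector_eq_rdot[THEN iffD1]) (simp add: R blinfun.scaleR_left)
    show "norm (R \<phi>) \<le> norm \<phi> * 1" for \<phi>
    proof -
      have "(norm (R \<phi>))\<^sup>2 = blinfun_apply \<phi> (R \<phi>)"
        by (simp add: power2_norm_eq_inner R)
      also have "\<dots> \<le> norm \<phi> * norm (R \<phi>)"
        using norm_blinfun[of \<phi> "R \<phi>"] by simp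
      finally show ?thesis
        by (cases "R \<phi> = 0") (auto simp: power2_eq_square)
    qed
  qed
  moreover have "(\<lambda>t. blinfun_inner_left (u t)) integrable_on {a..b}"
    by (intro integrable_continuous_real
        bounded_linear.continuous_on[OF bounded_linear_blinfun_inner_left] assms)
  ultimately have "(R \<circ> (\<lambda>t. blinfun_inner_left (u t))) integrable_on {a..b}"
    by (rule integrable_linear[rotated])
  moreover have "R (blinfun_inner_left v) = v" for v
    by (rule vector_eq_rdot[THEN iffD1]) (simp add: R inner_commute[of v])
  ultimately show ?thesis by (simp add: o_def)
qed

text \<open>A bounded functional passes through the integral. All later estimates of the average go
  through these scalar integrals.\<close>

lemma has_integral_inner_cesaro_average:
  fixes u :: "real \<Rightarrow> 'a::{real_inner, complete_space}"
  assumes "continuous_on {0..} u" and "t > 0"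
  shows "((\<lambda>s. inner (u s) h) has_integral t * inner (cesaro_average u t) h) {0..t}"
proof -
  have "continuous_on {0..t} u" using assms(1) by (rule continuous_on_subset) auto
  then have "(u has_integral integral {0..t} u) {0..t}"
    by (intro integrable_integral integrable_continuous_Hilbert)
  from has_integral_linear[OF this bounded_linear_inner_left[of h]]
  show ?thesis using assms(2) by (simp add: cesaro_average_def o_def)
qed

section \<open>Weak compactness\<close>

text \<open>Banach-Alaoglu for filters: each vector is viewed as the function \<open>h\<close> to
  \<open>inner (u i) h\<close>, a point in a product of compact intervals. Tychonoff yields a
  cluster point, which is a bounded functional and hence, by Riesz, a vector.\<close>

lemma weak_cluster_point:
  fixes u :: "'i \<Rightarrow> 'a::{real_inner, complete_space}"
  assumes "F \<noteq> bot" and bd: "\<forall>\<^sub>F i in F. norm (u i) \<le> M"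
  obtains G v where "G \<noteq> bot" "G \<le> F" "weakly_tendsto u v G"
proof -
  define U where "U = (\<Pi>\<^sub>E h\<in>UNIV. {- (norm (h::'a) * M)..norm h * M})"
  define W where "W i = (\<lambda>h. inner (u i) h)" for i
  have "compactin (product_topology (\<lambda>h::'a. euclideanreal) UNIV) U"
    unfolding U_def compactin_PiE by simp
  then have "compact U" by (simp add: euclidean_product_topology)
  moreover have "\<forall>\<^sub>F y in filtermap W F. y \<in> U"
    unfolding eventually_filtermap using bd
  proof eventually_elim
    case (elim i)
    have "\<bar>inner (u i) h\<bar> \<le> norm h * M" for h
      using Cauchy_Schwarz_ineq2[of "u i" h] mult_right_mono[OF elim norm_ge_zero[of h]]
      by (simp add: mult.commute)
    then show ?case by (auto simp: U_def W_def abs_le_iff minus_le_iff)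
  qed
  moreover have "filtermap W F \<noteq> bot" using assms(1) by (simp add: filtermap_bot_iff)
  ultimately obtain \<phi> where \<phi>: "\<phi> \<in> U" "inf (nhds \<phi>) (filtermap W F) \<noteq> bot"
    unfolding compact_filter by blast
  \<comment> \<open>The neighbourhoods of \<open>\<phi>\<close> are pulled back to the index set;
    \<open>G\<close> is proper exactly because \<open>\<phi>\<close> is a cluster point of the image
    filter.\<close>
  define G where "G = inf (filtercomap W (nhds \<phi>)) F"
  have "G \<noteq> bot"
  proof
    assume "G = bot"
    then obtain P Q where "eventually P (nhds \<phi>)" "eventually Q F" "\<And>i. P (W i) \<Longrightarrow> Q i \<Longrightarrow> False"
      unfolding G_def trivial_limit_def eventually_inf eventually_filtercomap by metis
    then have "\<forall>\<^sub>F y in inf (nhds \<phi>) (filtermap W F). False"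
      unfolding eventually_inf eventually_filtermap
      by (intro exI[of _ P] exI[of _ "\<lambda>y. \<exists>i. y = W i \<and> Q i"]) (auto elim: eventually_mono)
    then show False using \<phi>(2) by (simp add: trivial_limit_def)
  qed
  have "G \<le> F" by (simp add: G_def)
  have "(W \<longlongrightarrow> \<phi>) G"
    unfolding G_def by (rule filterlim_mono[OF filterlim_filtercomap order_refl]) simp
  then have lim: "((\<lambda>i. inner (u i) h) \<longlongrightarrow> \<phi> h) G" for h
    using continuous_on_tendsto_compose[OF continuous_on_product_coordinates[of h], of W \<phi> G]
    by (simp add: W_def)
  have "bounded_linear \<phi>"
  proof (rule bounded_linear_intro)
    fix x y :: 'a
    show "\<phi> (x + y) = \<phi> x + \<phi> y"
      using tendsto_unique[OF \<open>G \<noteq> bot\<close> lim[of "x + y"]] tendsto_add[OF lim[of x] lim[of y]]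
      by (simp add: inner_add_right)
    show "\<phi> (r *\<^sub>R x) = r *\<^sub>R \<phi> x" for r
      using tendsto_unique[OF \<open>G \<noteq> bot\<close> lim[of "r *\<^sub>R x"]] tendsto_mult_left[OF lim[of x], of r]
      by simp
    show "norm (\<phi> x) \<le> norm x * M"
      using \<phi>(1) by (auto simp: U_def abs_le_iff minus_le_iff dest: PiE_mem[of _ _ _ x])
  qed
  then obtain v where "\<And>h. \<phi> h = inner v h" using Riesz_representation by blast
  then have "weakly_tendsto u v G"
    using lim by (simp add: weakly_tendsto_iff_inner)
  then show ?thesis using that \<open>G \<noteq> bot\<close> \<open>G \<le> F\<close> by blast
qed

section \<open>Limits at infinity and the Opial-Passty lemma\<close>

text \<open>L'Hospital's rule for the quotient of the integral by \<open>t\<close>.\<close>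

lemma cesaro_average_tendsto:
  fixes q :: "real \<Rightarrow> real"
  assumes "continuous_on {0..} q" and "(q \<longlongrightarrow> L) at_top"
  shows "(cesaro_average q \<longlongrightarrow> L) at_top"
proof -
  have "((\<lambda>t. integral {0..t} q / t) \<longlongrightarrow> L) at_top"
  proof (rule lhospital_at_top_at_top[where g' = "\<lambda>_. 1" and f' = q])
    show "\<forall>\<^sub>F t in at_top. ((\<lambda>t. integral {0..t} q) has_real_derivative q t) (at t)"
      using eventually_gt_at_top[of 0]
    proof eventually_elim
      case (elim t)
      have "continuous_on {0..t+1} q" using assms(1) by (rule continuous_on_subset) auto
      from integral_has_real_derivative[OF this, of t] elim show ?case
        by (simp add: at_within_Icc_at)
    qed
    show "\<forall>\<^sub>F t in at_top. ((\<lambda>t::real. t) has_real_derivative 1) (at t)" by simp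
    show "((\<lambda>t. q t / 1) \<longlongrightarrow> L) at_top" using assms(2) by simp
  qed (simp_all add: filterlim_ident)
  then show ?thesis by (simp add: cesaro_average_def[abs_def])
qed

lemma antimono_nonneg_convergent_at_top:
  fixes e :: "real \<Rightarrow> real"
  assumes dec: "\<And>s t. 0 \<le> s \<Longrightarrow> s \<le> t \<Longrightarrow> e t \<le> e s" and nonneg: "\<And>t. 0 \<le> t \<Longrightarrow> 0 \<le> e t"
  shows "\<exists>L. (e \<longlongrightarrow> L) at_top"
proof (intro exI order_tendstoI)
  have bdd: "bdd_below (e ` {0..})" using nonneg by (intro bdd_belowI2[where m = 0]) auto
  fix a
  show "\<forall>\<^sub>F t in at_top. a < e t" if "a < Inf (e ` {0..})"
    using eventually_ge_at_top[of 0]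
  proof eventually_elim
    case (elim t)
    then have "Inf (e ` {0..}) \<le> e t" by (intro cInf_lower bdd) auto
    with that show ?case by simp
  qed
  show "\<forall>\<^sub>F t in at_top. e t < a" if a: "Inf (e ` {0..}) < a"
  proof -
    from cInf_lessD[OF _ a] obtain s where s: "0 \<le> s" "e s < a" by auto
    show ?thesis using eventually_ge_at_top[of s]
    proof eventually_elim
      case (elim t)
      from dec[OF s(1) elim] s(2) show ?case by simp
    qed
  qed
qed

text \<open>Convergent distances to \<open>S\<close> leave room for only one weak cluster point of
  the averages, and bounded averages with a single weak cluster point converge weakly.\<close>

theorem Opial_Passty:
  fixes u :: "real \<Rightarrow> 'a::{real_inner, complete_space}"
  assumes cont: "continuous_on {0..} u"
    and bound: "\<And>t. 0 \<le> t \<Longrightarrow> norm (u t) \<le> M"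
    and lim: "\<And>w. w \<in> S \<Longrightarrow> \<exists>L. ((\<lambda>t. (norm (u t - w))\<^sup>2) \<longlongrightarrow> L) at_top"
    and cluster: "\<And>G v. G \<noteq> bot \<Longrightarrow> G \<le> at_top \<Longrightarrow> weakly_tendsto (cesaro_average u) v G \<Longrightarrow> v \<in> S"
  shows "\<exists>v\<in>S. weakly_tendsto (cesaro_average u) v at_top"
proof -
  \<comment> \<open>Stated for every filter below \<open>at_top\<close>, since cluster points are
    extracted twice: from \<open>at_top\<close> itself and from a finer filter in the final
    contradiction.\<close>
  have bd: "\<forall>\<^sub>F t in F. norm (cesaro_average u t) \<le> M" if "F \<le> at_top" for F
  proof (rule filter_leD[OF that])
    show "\<forall>\<^sub>F t in at_top. norm (cesaro_average u t) \<le> M"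
      using eventually_gt_at_top[of 0]
    proof eventually_elim
      case (elim t)
      let ?m = "cesaro_average u t"
      \<comment> \<open>Pairing with the average itself bounds \<open>inner ?m ?m\<close> by
        \<open>M * norm ?m\<close>, so only scalar integrals are compared.\<close>
      have "inner (u s) ?m \<le> M * norm ?m" if "s \<in> {0..t}" for s
      proof -
        have "inner (u s) ?m \<le> norm (u s) * norm ?m" by (rule norm_cauchy_schwarz)
        also have "\<dots> \<le> M * norm ?m" using bound[of s] that by (intro mult_right_mono) auto
        finally show ?thesis .
      qed
      moreover have "((\<lambda>s. M * norm ?m) has_integral t * (M * norm ?m)) {0..t}"
        using has_integral_const_real[of "M * norm ?m" 0 t] elim by simp
      ultimately have "t * inner ?m ?m \<le> t * (M * norm ?m)"
        by (intro has_integral_le[OF has_integral_inner_cesaro_average[OF cont elim]])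
      then have "norm ?m * norm ?m \<le> M * norm ?m"
        using elim by (simp add: power2_norm_eq_inner[symmetric] power2_eq_square)
      moreover have "M \<ge> 0" using bound[of 0] norm_ge_zero[of "u 0"] by linarith
      ultimately show ?case by (cases "?m = 0") auto
    qed
  qed
  have unique: "v = w"
    if G: "G \<noteq> bot" "G \<le> at_top" "weakly_tendsto (cesaro_average u) v G"
      and H: "H \<noteq> bot" "H \<le> at_top" "weakly_tendsto (cesaro_average u) w H" for G H v w
  proof -
    obtain K L where "((\<lambda>t. (norm (u t - v))\<^sup>2) \<longlongrightarrow> K) at_top" "((\<lambda>t. (norm (u t - w))\<^sup>2) \<longlongrightarrow> L) at_top"
      using lim cluster[OF G] cluster[OF H] by blast
    \<comment> \<open>The quadratic term in \<open>u t\<close> cancels from the difference of the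
      squared distances, leaving an affine function of \<open>u t\<close>.\<close>
    then have "((\<lambda>t. ((norm (u t - w))\<^sup>2 - (norm (u t - v))\<^sup>2 + inner v v - inner w w) / 2)
        \<longlongrightarrow> (L - K + inner v v - inner w w) / 2) at_top" (is "(_ \<longlongrightarrow> ?c) _")
      by (intro tendsto_intros) auto
    moreover have "((norm (u t - w))\<^sup>2 - (norm (u t - v))\<^sup>2 + inner v v - inner w w) / 2 = inner (u t) (v - w)" for t
      by (simp add: power2_norm_eq_inner inner_diff_left inner_diff_right inner_commute)
    ultimately have "((\<lambda>t. inner (u t) (v - w)) \<longlongrightarrow> ?c) at_top" by simp
    then have "(cesaro_average (\<lambda>t. inner (u t) (v - w)) \<longlongrightarrow> ?c) at_top"
      by (intro cesaro_average_tendsto continuous_intros cont)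
    moreover have "\<forall>\<^sub>F t in at_top.
        cesaro_average (\<lambda>t. inner (u t) (v - w)) t = inner (cesaro_average u t) (v - w)"
      using eventually_gt_at_top[of 0]
    proof eventually_elim
      case (elim t)
      from integral_unique[OF has_integral_inner_cesaro_average[OF cont elim, of "v - w"]] elim
      show ?case by (simp add: cesaro_average_def[of "\<lambda>t. inner (u t) (v - w)"])
    qed
    ultimately have c: "((\<lambda>t. inner (cesaro_average u t) (v - w)) \<longlongrightarrow> ?c) at_top"
      by (rule Lim_transform_eventually)
    have "inner v (v - w) = ?c"
      using tendsto_unique[OF G(1) _ tendsto_mono[OF G(2) c]] G(3) by (auto simp: weakly_tendsto_iff_inner)
    moreover have "inner w (v - w) = ?c"
      using tendsto_unique[OF H(1) _ tendsto_mono[OF H(2) c]] H(3) by (auto simp: weakly_tendsto_iff_inner)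
    ultimately have "inner (v - w) (v - w) = 0" by (simp add: inner_diff_left)
    then show ?thesis by simp
  qed
  obtain G v where G: "G \<noteq> bot" "G \<le> at_top" "weakly_tendsto (cesaro_average u) v G"
    using weak_cluster_point[OF trivial_limit_at_top_linorder bd[OF order_refl]] by blast
  have "((\<lambda>t. inner (cesaro_average u t) h) \<longlongrightarrow> inner v h) at_top" for h
  proof (rule topological_tendstoI, rule ccontr)
    fix T :: "real set" assume T: "open T" "inner v h \<in> T"
      and not: "\<not> (\<forall>\<^sub>F t in at_top. inner (cesaro_average u t) h \<in> T)"
    \<comment> \<open>\<open>F\<close> keeps only the times at which the average stays outside
      \<open>T\<close>. A cluster point along \<open>F\<close> must equal \<open>v\<close>, which
      puts the values into \<open>T\<close>.\<close>
    define F where "F = inf at_top (principal {t. inner (cesaro_average u t) h \<notin> T})"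
    have "F \<noteq> bot"
      using not by (simp add: F_def trivial_limit_def eventually_inf_principal)
    moreover have "F \<le> at_top" by (simp add: F_def)
    ultimately obtain H w where H: "H \<noteq> bot" "H \<le> F" "weakly_tendsto (cesaro_average u) w H"
      using weak_cluster_point[OF _ bd] by metis
    have "w = v" using unique[OF H(1) order_trans[OF H(2) \<open>F \<le> at_top\<close>] H(3) G] .
    then have "\<forall>\<^sub>F t in H. inner (cesaro_average u t) h \<in> T"
      using H(3) topological_tendstoD[OF _ T, of "\<lambda>t. inner (cesaro_average u t) h" H]
      by (simp add: weakly_tendsto_iff_inner)
    moreover have "\<forall>\<^sub>F t in H. inner (cesaro_average u t) h \<notin> T"
      by (rule filter_leD[OF H(2)]) (simp add: F_def eventually_inf_principal)
    ultimately have "\<forall>\<^sub>F t in H. False" by eventually_elim simp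
    then show False using H(1) by (simp add: trivial_limit_def)
  qed
  then show ?thesis using cluster[OF G] by (auto simp: weakly_tendsto_iff_inner)
qed

section \<open>Ergodic behaviour of dissipative flows\<close>

text \<open>The squared distance to \<open>w\<close> has derivative
  \<open>2 * inner (u' r) (u r - w)\<close>. The minorant \<open>p\<close>, with known integral,
  stands in for the gap along the flow: an affine support function gives the rate, and
  \<open>0\<close> gives monotone distances to \<open>S\<close>.\<close>

lemma dissipative_flow_estimate:
  fixes u u' :: "real \<Rightarrow> 'a::{real_inner, complete_space}" and \<Phi> :: "'a \<Rightarrow> 'a \<Rightarrow> real"
  assumes deriv: "\<And>t. 0 \<le> t \<Longrightarrow> (u has_vector_derivative u' t) (at t within {0..})"
    and dissip: "\<And>t w. 0 \<le> t \<Longrightarrow> inner (u' t) (u t - w) \<le> - \<Phi> w (u t)"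
    and lower: "0 \<le> s" "s \<le> t" "\<And>r. r \<in> {s..t} \<Longrightarrow> p r \<le> \<Phi> w (u r)" "(p has_integral I) {s..t}"
  shows "(norm (u t - w))\<^sup>2 + 2 * I \<le> (norm (u s - w))\<^sup>2"
proof -
  have "((\<lambda>r. 2 * inner (u' r) (u r - w)) has_integral
      inner (u t - w) (u t - w) - inner (u s - w) (u s - w)) {s..t}"
  proof (rule fundamental_theorem_of_calculus[OF lower(2)])
    fix r assume r: "r \<in> {s..t}"
    have "(u has_vector_derivative u' r) (at r within {s..t})"
      using deriv[of r] r lower(1) by (auto intro: has_vector_derivative_within_subset)
    then have "((\<lambda>r. u r - w) has_derivative (\<lambda>h. h *\<^sub>R u' r)) (at r within {s..t})"
      by (auto simp: has_vector_derivative_def intro!: derivative_eq_intros)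
    from has_derivative_inner[OF this this]
    show "((\<lambda>r. inner (u r - w) (u r - w)) has_vector_derivative 2 * inner (u' r) (u r - w)) (at r within {s..t})"
      by (simp add: has_vector_derivative_def inner_commute algebra_simps)
  qed
  moreover have "((\<lambda>r. - 2 * p r) has_integral - 2 * I) {s..t}"
    by (intro has_integral_mult_right lower)
  moreover have "2 * inner (u' r) (u r - w) \<le> - 2 * p r" if "r \<in> {s..t}" for r
    using dissip[of r w] lower(1) lower(3)[OF that] that by simp
  ultimately have "inner (u t - w) (u t - w) - inner (u s - w) (u s - w) \<le> - 2 * I"
    by (rule has_integral_le)
  then show ?thesis by (simp add: power2_norm_eq_inner)
qed

text \<open>The affine minorants in \<open>subgradient\<close> serve twice: they give Jensen's
  inequality for the average and weak lower semicontinuity at cluster points. By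
  \<open>skew\<close>, a point \<open>w\<close> of \<open>S\<close> has a nonnegative gap
  \<open>\<Phi> w v\<close> for all \<open>v\<close>.\<close>

theorem dissipative_flow_ergodic:
  fixes u u' :: "real \<Rightarrow> 'a::{real_inner, complete_space}" and \<Phi> :: "'a \<Rightarrow> 'a \<Rightarrow> real"
  assumes deriv: "\<And>t. 0 \<le> t \<Longrightarrow> (u has_vector_derivative u' t) (at t within {0..})"
    and dissip: "\<And>t w. 0 \<le> t \<Longrightarrow> inner (u' t) (u t - w) \<le> - \<Phi> w (u t)"
    and skew: "\<And>v w. \<Phi> v w = - \<Phi> w v"
    and subgradient: "\<And>w m. \<exists>k. \<forall>v. \<Phi> w m + inner (v - m) k \<le> \<Phi> w v"
  defines "S \<equiv> {v. \<forall>w. \<Phi> w v \<le> 0}"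
  shows dissipative_flow_rate: "0 < t \<Longrightarrow> \<Phi> w (cesaro_average u t) \<le> (norm (u 0 - w))\<^sup>2 / (2 * t)"
    and dissipative_flow_weak_limit: "S \<noteq> {} \<Longrightarrow> \<exists>v\<in>S. weakly_tendsto (cesaro_average u) v at_top"
proof -
  have cont: "continuous_on {0..} u"
    using deriv by (auto simp: continuous_on_eq_continuous_within intro: has_vector_derivative_continuous)
  show rate: "\<Phi> w (cesaro_average u t) \<le> (norm (u 0 - w))\<^sup>2 / (2 * t)" if t: "0 < t" for w t
  proof -
    let ?m = "cesaro_average u t"
    obtain k where k: "\<And>v. \<Phi> w ?m + inner (v - ?m) k \<le> \<Phi> w v"
      using subgradient by meson
    \<comment> \<open>The support function is taken at the average itself, so its linear part
      integrates to zero.\<close>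
    have "((\<lambda>r. \<Phi> w ?m + (inner (u r) k - inner ?m k)) has_integral
        t * \<Phi> w ?m + (t * inner ?m k - t * inner ?m k)) {0..t}"
      using has_integral_const_real[of "\<Phi> w ?m" 0 t] has_integral_const_real[of "inner ?m k" 0 t] t
      by (intro has_integral_add has_integral_diff has_integral_inner_cesaro_average[OF cont t]) simp_all
    then have "((\<lambda>r. \<Phi> w ?m + inner (u r - ?m) k) has_integral t * \<Phi> w ?m) {0..t}"
      by (simp add: inner_diff_left)
    from dissipative_flow_estimate[OF deriv dissip _ _ k this] t
    have "(norm (u t - w))\<^sup>2 + 2 * (t * \<Phi> w ?m) \<le> (norm (u 0 - w))\<^sup>2" by simp
    then have "2 * (t * \<Phi> w ?m) \<le> (norm (u 0 - w))\<^sup>2"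
      using zero_le_power2[of "norm (u t - w)"] by linarith
    then show ?thesis using t by (simp add: field_simps)
  qed
  assume "S \<noteq> {}"
  obtain p where p: "p \<in> S" using \<open>S \<noteq> {}\<close> by blast
  have dec: "(norm (u t - w))\<^sup>2 \<le> (norm (u s - w))\<^sup>2" if "w \<in> S" "0 \<le> s" "s \<le> t" for w s t
  proof -
    have "0 \<le> \<Phi> w v" for v using that(1) skew[of w v] by (simp add: S_def)
    then show ?thesis
      using dissipative_flow_estimate[OF deriv dissip that(2,3), of "\<lambda>_. 0" w 0] by simp
  qed
  show "\<exists>v\<in>S. weakly_tendsto (cesaro_average u) v at_top"
  proof (rule Opial_Passty[OF cont])
    show "norm (u t) \<le> norm p + norm (u 0 - p)" if "0 \<le> t" for t
      using dec[OF p order_refl that] norm_triangle_sub[of "u t" p] by (simp add: power2_le_iff_abs_le)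
    show "\<exists>L. ((\<lambda>t. (norm (u t - w))\<^sup>2) \<longlongrightarrow> L) at_top" if "w \<in> S" for w
      by (rule antimono_nonneg_convergent_at_top) (use dec that in auto)
    fix G v assume G: "G \<noteq> bot" "G \<le> at_top" "weakly_tendsto (cesaro_average u) v G"
    have "\<Phi> w v \<le> 0" for w
    proof -
      obtain k where k: "\<And>v'. \<Phi> w v + inner (v' - v) k \<le> \<Phi> w v'"
        using subgradient by meson
      have "((\<lambda>t. (norm (u 0 - w))\<^sup>2 / (2 * t)) \<longlongrightarrow> 0) at_top" 
        by (intro tendsto_divide_0[OF tendsto_const] filterlim_at_top_imp_at_infinity
            filterlim_tendsto_pos_mult_at_top[OF tendsto_const _ filterlim_ident]) simp
      then have upper: "((\<lambda>t. (norm (u 0 - w))\<^sup>2 / (2 * t)) \<longlongrightarrow> 0) G" by (rule tendsto_mono[OF G(2)])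
      \<comment> \<open>The affine minorant is weakly continuous, so its value along
        \<open>G\<close> tends to \<open>\<Phi> w v\<close>, while the rate estimate forces its
        upper bound to 0.\<close>
      have "((\<lambda>t. \<Phi> w v + (inner (cesaro_average u t) k - inner v k)) \<longlongrightarrow>
          \<Phi> w v + (inner v k - inner v k)) G"
        using G(3) unfolding weakly_tendsto_iff_inner
        by (intro tendsto_add tendsto_diff tendsto_const) blast
      then have lower: "((\<lambda>t. \<Phi> w v + inner (cesaro_average u t - v) k) \<longlongrightarrow> \<Phi> w v) G"
        by (simp add: inner_diff_left)
      have "\<forall>\<^sub>F t in G. \<Phi> w v + inner (cesaro_average u t - v) k \<le> (norm (u 0 - w))\<^sup>2 / (2 * t)"
        using filter_leD[OF G(2) eventually_gt_at_top[of 0]]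
        by eventually_elim (rule order_trans[OF k rate])
      then show ?thesis by (rule tendsto_le[OF G(1) upper lower])
    qed
    then show "v \<in> S" by (simp add: S_def)
  qed
qed

section \<open>The saddle gap of the Lagrangian\<close>

definition saddle_gap :: "('x \<Rightarrow> 'y \<Rightarrow> 'z \<Rightarrow> real) \<Rightarrow> 'x \<times> 'y \<times> 'z \<Rightarrow> 'x \<times> 'y \<times> 'z \<Rightarrow> real" where
  "saddle_gap L = (\<lambda>(\<xi>, \<psi>, \<eta>) (x, y, l). L x y \<eta> - L \<xi> \<psi> l)"

text \<open>Chaining the two saddle inequalities eliminates the middle value; choosing
  \<open>l = l'\<close>, or \<open>x = x'\<close> and \<open>y = y'\<close>, recovers them.\<close>

lemma saddle_points_eq:
  fixes L :: "'a \<Rightarrow> 'b \<Rightarrow> 'c \<Rightarrow> real"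
  shows "saddle_points L = {v. \<forall>w. saddle_gap L w v \<le> 0}"
proof (rule set_eqI)
  fix v :: "'a \<times> 'b \<times> 'c"
  obtain x' y' l' where v: "v = (x', y', l')" by (cases v)
  have "(\<forall>x y l. L x' y' l \<le> L x' y' l' \<and> L x' y' l' \<le> L x y l') \<longleftrightarrow> (\<forall>x y l. L x' y' l \<le> L x y l')"
    by (meson order_trans)
  then show "v \<in> saddle_points L \<longleftrightarrow> v \<in> {v. \<forall>w. saddle_gap L w v \<le> 0}"
    by (simp add: v saddle_points_def saddle_gap_def)
qed

lemma saddle_gap_skew: "saddle_gap L v w = - saddle_gap L w v"
  by (simp add: saddle_gap_def case_prod_beta)

text \<open>In its second argument the gap is \<open>f\<close> plus \<open>g\<close> plus an affine
  function, so the tangent inequalities for \<open>f\<close> and \<open>g\<close> suffice;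
  \<open>c - A \<xi> - B \<psi>\<close> is the coefficient of the multiplier.\<close>

lemma saddle_gap_lagrangian_subgradient:
  fixes f :: "'x::{real_inner, complete_space} \<Rightarrow> real"
    and g :: "'y::{real_inner, complete_space} \<Rightarrow> real"
    and A :: "'x \<Rightarrow> 'z::real_inner"
  assumes f: "convex_on UNIV f" "cont_differentiable f"
    and g: "convex_on UNIV g" "cont_differentiable g"
    and A: "bounded_linear A" and B: "bounded_linear B"
  shows "saddle_gap (lagrangian f g A B c) (\<xi>, \<psi>, \<eta>) (x, y, l)
      + inner (v - (x, y, l))
          (gradient f x + adjoint A \<eta>, gradient g y + adjoint B \<eta>, c - A \<xi> - B \<psi>)
    \<le> saddle_gap (lagrangian f g A B c) (\<xi>, \<psi>, \<eta>) v"
proof -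
  obtain x' y' l' where v: "v = (x', y', l')" by (cases v)
  have "f x + inner (gradient f x) (x' - x) \<le> f x'" "g y + inner (gradient g y) (y' - y) \<le> g y'"
    by (intro convex_on_GDERIV_above_tangent GDERIV_gradient f g)+
  moreover have "inner (x' - x) (adjoint A \<eta>) = inner \<eta> (A x' - A x)"
      "inner (y' - y) (adjoint B \<eta>) = inner \<eta> (B y' - B y)"
    by (simp_all add: inner_commute[of "x' - x"] inner_commute[of "y' - y"] adjoint_bounded_linear
        linear_diff[OF bounded_linear.linear] A B del: inner_diff_right)
  ultimately show ?thesis
    by (simp add: v saddle_gap_def lagrangian_def inner_Pair inner_add_right inner_diff_right
        inner_diff_left inner_add_left inner_commute)
qed

text \<open>The bilinear terms \<open>inner l (A x + B y)\<close> from the primal and multiplier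
  equations cancel. What remains is bounded by convexity of \<open>f\<close> and
  \<open>g\<close>.\<close>

lemma gah_field_dissipative:
  fixes f :: "'x::{real_inner, complete_space} \<Rightarrow> real"
    and g :: "'y::{real_inner, complete_space} \<Rightarrow> real"
    and A :: "'x \<Rightarrow> 'z::real_inner"
  assumes f: "convex_on UNIV f" "cont_differentiable f"
    and g: "convex_on UNIV g" "cont_differentiable g"
    and A: "bounded_linear A" and B: "bounded_linear B"
  shows "inner (- gradient f x - adjoint A l, - gradient g y - adjoint B l, A x + B y - c) ((x, y, l) - w)
    \<le> - saddle_gap (lagrangian f g A B c) w (x, y, l)"
proof -
  obtain \<xi> \<psi> \<eta> where w: "w = (\<xi>, \<psi>, \<eta>)" by (cases w)
  have "f x + inner (gradient f x) (\<xi> - x) \<le> f \<xi>" "g y + inner (gradient g y) (\<psi> - y) \<le> g \<psi>"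
    by (intro convex_on_GDERIV_above_tangent GDERIV_gradient f g)+
  moreover have "inner (adjoint A l) (x - \<xi>) = inner l (A x - A \<xi>)"
      "inner (adjoint B l) (y - \<psi>) = inner l (B y - B \<psi>)"
    by (simp_all add: adjoint_bounded_linear
        linear_diff[OF bounded_linear.linear] A B del: inner_diff_right)
  ultimately show ?thesis
    by (simp add: w saddle_gap_def lagrangian_def inner_Pair inner_add_right inner_diff_right
        inner_diff_left inner_add_left inner_commute)
qed

section \<open>The generalized Arrow-Hurwicz flow\<close>

theorem proposition5p2:
  fixes f :: "'x::{real_inner, complete_space} \<Rightarrow> real"
    and g :: "'y::{real_inner, complete_space} \<Rightarrow> real"
    and A :: "'x \<Rightarrow> 'z::{real_inner, complete_space}"
    and B :: "'y \<Rightarrow> 'z"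
    and c :: 'z
    and x0 :: 'x and y0 :: 'y and l0 :: 'z
    and x \<sigma> :: "real \<Rightarrow> 'x" and y \<tau> :: "real \<Rightarrow> 'y" and l \<omega> :: "real \<Rightarrow> 'z"
  assumes "convex_on UNIV f" and "convex_on UNIV g"
    and "cont_differentiable f" and "cont_differentiable g"
    and "lipschitz_on_bounded_sets (gradient f)"
    and "lipschitz_on_bounded_sets (gradient g)"
    and "bounded_linear A" and "bounded_linear B"
    and "saddle_points (lagrangian f g A B c) \<noteq> {}"
    and "gah_solution f g A B c x0 y0 l0 x y l"
    and "\<And>t. t > 0 \<Longrightarrow> (\<sigma> t, \<tau> t, \<omega> t) = cesaro_average (\<lambda>s. (x s, y s, l s)) t"
  shows "(\<forall>(\<xi>, \<psi>, \<eta>) \<in> saddle_points (lagrangian f g A B c).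
            (\<lambda>t. lagrangian f g A B c (\<sigma> t) (\<tau> t) \<eta> - lagrangian f g A B c \<xi> \<psi> (\<omega> t))
              \<in> O[at_top](\<lambda>t. 1 / t)) \<and>
         (\<exists>v \<in> saddle_points (lagrangian f g A B c).
            weakly_tendsto (\<lambda>t. (\<sigma> t, \<tau> t, \<omega> t)) v at_top)"
proof -
  let ?L = "lagrangian f g A B c" and ?u = "\<lambda>t. (x t, y t, l t)"
  let ?\<Phi> = "saddle_gap ?L"
  let ?u' = "\<lambda>t. (- gradient f (x t) - adjoint A (l t), - gradient g (y t) - adjoint B (l t),
    A (x t) + B (y t) - c)"
  note fgAB = assms(1,3,2,4,7,8)
  have deriv: "(?u has_vector_derivative ?u' t) (at t within {0..})" if t: "0 \<le> t" for t
  proof -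
    obtain x' y' l' where "(x has_vector_derivative x') (at t within {0..})"
        "(y has_vector_derivative y') (at t within {0..})"
        "(l has_vector_derivative l') (at t within {0..})"
      and eq: "x' + gradient f (x t) + adjoint A (l t) = 0" "y' + gradient g (y t) + adjoint B (l t) = 0"
        "l' + c - A (x t) - B (y t) = 0"
      using assms(10) t unfolding gah_solution_def by blast
    then have "(?u has_vector_derivative (x', y', l')) (at t within {0..})"
      by (intro has_vector_derivative_Pair)
    moreover have "x' = - gradient f (x t) - adjoint A (l t)" "y' = - gradient g (y t) - adjoint B (l t)"
        "l' = A (x t) + B (y t) - c"
      using eq by (simp_all add: algebra_simps eq_neg_iff_add_eq_0)
    ultimately show ?thesis by simp
  qed
  have subgradient: "\<exists>k. \<forall>v. ?\<Phi> w m + inner (v - m) k \<le> ?\<Phi> w v" for w m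
    using saddle_gap_lagrangian_subgradient[OF fgAB] by (cases w, cases m) blast
  \<comment> \<open>These are the four hypotheses of the abstract ergodic theorem, with the saddle
    gap as \<open>\<Phi>\<close>.\<close>
  note flow = deriv gah_field_dissipative[OF fgAB] saddle_gap_skew subgradient
  have avg: "(\<sigma> t, \<tau> t, \<omega> t) = cesaro_average ?u t" if "0 < t" for t
    using assms(11) that .
  have "(\<lambda>t. ?L (\<sigma> t) (\<tau> t) \<eta> - ?L \<xi> \<psi> (\<omega> t)) \<in> O[at_top](\<lambda>t. 1 / t)"
    if "(\<xi>, \<psi>, \<eta>) \<in> saddle_points ?L" for \<xi> \<psi> \<eta>
  proof (rule bigoI)
    let ?w = "(\<xi>, \<psi>, \<eta>)"
    show "\<forall>\<^sub>F t in at_top. norm (?L (\<sigma> t) (\<tau> t) \<eta> - ?L \<xi> \<psi> (\<omega> t))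
        \<le> (norm (?u 0 - ?w))\<^sup>2 / 2 * norm (1 / t)"
      using eventually_gt_at_top[of 0]
    proof eventually_elim
      case (elim t)
      have "?L (\<sigma> t) (\<tau> t) \<eta> - ?L \<xi> \<psi> (\<omega> t) = ?\<Phi> ?w (cesaro_average ?u t)"
        by (simp add: avg[OF elim, symmetric] saddle_gap_def)
      \<comment> \<open>Big-O bounds an absolute value, so the upper rate needs this lower bound,
        which holds because \<open>?w\<close> is a saddle point.\<close>
      moreover have "0 \<le> ?\<Phi> ?w (cesaro_average ?u t)"
        using that saddle_gap_skew[of ?L ?w "cesaro_average ?u t"] by (simp add: saddle_points_eq del: split_paired_All)
      moreover have "?\<Phi> ?w (cesaro_average ?u t) \<le> (norm (?u 0 - ?w))\<^sup>2 / (2 * t)"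
        by (rule dissipative_flow_rate[OF flow elim])
      ultimately show ?case using elim by simp
    qed
  qed
  moreover have "\<exists>v\<in>saddle_points ?L. weakly_tendsto (\<lambda>t. (\<sigma> t, \<tau> t, \<omega> t)) v at_top"
  proof -
    obtain v where v: "v \<in> saddle_points ?L" "weakly_tendsto (cesaro_average ?u) v at_top"
      using dissipative_flow_weak_limit[OF flow] assms(9) by (auto simp: saddle_points_eq simp del: split_paired_All)
    \<comment> \<open>The given triple agrees with the average only for positive times, so the weak
      limit is transferred through eventual equality.\<close>
    have "\<forall>\<^sub>F t in at_top. cesaro_average ?u t = (\<sigma> t, \<tau> t, \<omega> t)"
      using eventually_gt_at_top[of 0] by eventually_elim (simp add: avg)
    then have ev: "\<forall>\<^sub>F t in at_top. \<phi> (cesaro_average ?u t) = \<phi> (\<sigma> t, \<tau> t, \<omega> t)"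
      for \<phi> :: "'x \<times> 'y \<times> 'z \<Rightarrow> real"
      by eventually_elim simp
    have "((\<lambda>t. \<phi> (\<sigma> t, \<tau> t, \<omega> t)) \<longlongrightarrow> \<phi> v) at_top"
      if "bounded_linear \<phi>" for \<phi> :: "'x \<times> 'y \<times> 'z \<Rightarrow> real"
      using v(2) that unfolding weakly_tendsto_def by (intro Lim_transform_eventually[OF _ ev]) blast
    then have "weakly_tendsto (\<lambda>t. (\<sigma> t, \<tau> t, \<omega> t)) v at_top"
      by (simp add: weakly_tendsto_def)
    with v(1) show ?thesis by blast
  qed
  ultimately show ?thesis by blast
qed

end
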